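(* Let $\gamma\in[0,1)$ and let $\mu_n(\mathbf{s}_e\mid \mathbf{s}_t;\gamma)$ denote the distribution over states at the $n$-th sequential step ($n\ge 1$) of a $\gamma$-model rollout beginning from state $\mathbf{s}_t$. For any desired discount $\tilde\gamma\in[\gamma,1)$, define the weights $$\alpha_n=\frac{(1-\tilde\gamma)(\tilde\gamma-\gamma)^{n-1}}{(1-\gamma)^n},\qquad n\ge 1.$$ Then, for every state $\mathbf{s}_t$, reweighting the steps of the $\gamma$-model rollout by $\alpha_n$ yields the discounted occupancy $\mu_1(\cdot\mid\mathbf{s}_t;\tilde\gamma)=\mu(\cdot\mid\mathbf{s}_t;\tilde\gamma)$ with the larger discount $\tilde\gamma$: $$\mu(\mathbf{s}_e\mid \mathbf{s}_t;\tilde\gamma)=\sum_{n=1}^{\infty}\alpha_n\,\mu_n(\mathbf{s}_e\mid \mathbf{s}_t;\gamma).$$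
   Context: Setting: a Markov decision process with state space $\mathcal{S}$, action space $\mathcal{A}$ and transition distribution $p(\mathbf{s}_{t+1}\mid \mathbf{s}_t,\mathbf{a}_t)$, together with a fixed policy $\pi(\mathbf{a}\mid\mathbf{s})$. Discounted occupancy: for a discount $\gamma\in[0,1)$, $$\mu(\mathbf{s}\mid \mathbf{s}_t,\mathbf{a}_t;\gamma)=(1-\gamma)\sum_{\Delta t=1}^{\infty}\gamma^{\Delta t-1}\,p(\mathbf{s}_{t+\Delta t}=\mathbf{s}\mid \mathbf{s}_t,\mathbf{a}_t,\pi),$$ where $p(\mathbf{s}_{t+\Delta t}=\cdot\mid \mathbf{s}_t,\mathbf{a}_t,\pi)$ is the law (or density) of the state $\Delta t$ steps later when the first action is $\mathbf{a}_t$ and all later actions are drawn from $\pi$. The state-conditioned occupancy is $\mu(\mathbf{s}\mid\mathbf{s}_t;\gamma)=\mathbb{E}_{\mathbf{a}_t\sim\pi(\cdot\mid\mathbf{s}_t)}[\mu(\mathbf{s}\mid\mathbf{s}_t,\mathbf{a}_t;\gamma)]$. Equivalently, one samples $\Delta t\sim\mathrm{Geom}(1-\gamma)$ on $\{1,2,\dots\}$ (independently of the state process) and returns the state reached after $\Delta t$ steps of the Markov chain induced by $\pi$. $\gamma$-model rollout: a $\gamma$-model with discount $\gamma$ samples from $\mu(\cdot\mid\mathbf{s};\gamma)$. A rollout iterates this sampling, conditioning each step on the output of the previous step: $\mu_1(\cdot\mid\mathbf{s}_t;\gamma)=\mu(\cdot\mid\mathbf{s}_t;\gamma)$ and, for $n\ge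 2$, $\mu_n(\cdot\mid\mathbf{s}_t;\gamma)=\mathbb{E}_{\mathbf{s}'\sim\mu_{n-1}(\cdot\mid\mathbf{s}_t;\gamma)}[\mu(\cdot\mid\mathbf{s}';\gamma)]$. Conventions: $0^0=1$. The equality is an equality of probability distributions on $\mathcal{S}$. *)

theory Defs
  imports "HOL-Probability.Probability"
begin

text \<open>A Markov decision process is given by measurable spaces \<open>S\<close> of states and \<open>A\<close> of
  actions and a probability kernel \<open>P\<close> from state-action pairs to states; a policy \<open>\<pi>\<close> is a
  probability kernel from states to actions. Expectations of distribution-valued maps are monadic
  binds in the Giry monad.\<close>

text \<open>The measure with value \<open>\<Sum>n\<ge>1. w n * M n B\<close> at each event \<open>B\<close>; values at
  index 0 are ignored. Weights are meant to be nonnegative: \<open>ennreal\<close> maps negative reals to 0.\<close>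

definition mixture :: "'s measure \<Rightarrow> (nat \<Rightarrow> real) \<Rightarrow> (nat \<Rightarrow> 's measure) \<Rightarrow> 's measure" where
  "mixture S w M = measure_of (space S) (sets S)
     (\<lambda>B. \<Sum>n. ennreal (w (Suc n)) * emeasure (M (Suc n)) B)"

lemma space_mixture [simp]: "space (mixture S w M) = space S"
  by (simp add: mixture_def)

lemma sets_mixture [simp, measurable_cong]: "sets (mixture S w M) = sets S"
  by (simp add: mixture_def)

lemma emeasure_mixture:
  assumes M: "\<And>n. n \<ge> 1 \<Longrightarrow> sets (M n) = sets S" and B: "B \<in> sets S"
  shows "emeasure (mixture S w M) B = (\<Sum>n. ennreal (w (Suc n)) * emeasure (M (Suc n)) B)"
proof (rule emeasure_measure_of[OF mixture_def])
  show "sets S \<subseteq> Pow (space S)"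
    by (rule sets.space_closed)
  show "B \<in> sets (mixture S w M)"
    using B by simp
  show "positive (sets (mixture S w M))
      (\<lambda>B. \<Sum>n. ennreal (w (Suc n)) * emeasure (M (Suc n)) B)"
    by (simp add: positive_def)
  show "countably_additive (sets (mixture S w M))
      (\<lambda>B. \<Sum>n. ennreal (w (Suc n)) * emeasure (M (Suc n)) B)"
  proof (rule countably_additiveI)
    fix F :: "nat \<Rightarrow> 'a set"
    assume F: "range F \<subseteq> sets (mixture S w M)" "disjoint_family F"
    have e: "(\<Sum>i. emeasure (M (Suc n)) (F i)) = emeasure (M (Suc n)) (\<Union>i. F i)" for n
      using F M[of "Suc n"] by (intro suminf_emeasure) auto
    have "(\<Sum>i. \<Sum>n. ennreal (w (Suc n)) * emeasure (M (Suc n)) (F i)) =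
        (\<Sum>n. \<Sum>i. ennreal (w (Suc n)) * emeasure (M (Suc n)) (F i))"
      using nn_integral_suminf[of "\<lambda>n i. ennreal (w (Suc n)) * emeasure (M (Suc n)) (F i)"
          "count_space UNIV"]
      by (simp add: nn_integral_count_space_nat)
    then show "(\<Sum>i. \<Sum>n. ennreal (w (Suc n)) * emeasure (M (Suc n)) (F i)) =
        (\<Sum>n. ennreal (w (Suc n)) * emeasure (M (Suc n)) (\<Union>i. F i))"
      by (simp add: e)
  qed
qed

text \<open>\<open>state_law S P \<pi> k s a\<close> is the law of the state \<open>k\<close> steps after \<open>s\<close> when the first action
  is \<open>a\<close> and all later actions are drawn from \<open>\<pi>\<close>.\<close>

fun state_law :: "'s measure \<Rightarrow> ('s \<times> 'a \<Rightarrow> 's measure) \<Rightarrow> ('s \<Rightarrow> 'a measure) \<Rightarrow>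
    nat \<Rightarrow> 's \<Rightarrow> 'a \<Rightarrow> 's measure" where
  "state_law S P \<pi> 0 s a = return S s"
| "state_law S P \<pi> (Suc 0) s a = P (s, a)"
| "state_law S P \<pi> (Suc (Suc k)) s a =
     state_law S P \<pi> (Suc k) s a \<bind> (\<lambda>s'. \<pi> s' \<bind> (\<lambda>a'. P (s', a')))"

definition occupancy :: "'s measure \<Rightarrow> ('s \<times> 'a \<Rightarrow> 's measure) \<Rightarrow> ('s \<Rightarrow> 'a measure) \<Rightarrow>
    real \<Rightarrow> 's \<Rightarrow> 'a \<Rightarrow> 's measure" where
  "occupancy S P \<pi> \<gamma> s a =
     mixture S (\<lambda>k. (1 - \<gamma>) * \<gamma> ^ (k - 1)) (\<lambda>k. state_law S P \<pi> k s a)"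

definition state_occupancy :: "'s measure \<Rightarrow> ('s \<times> 'a \<Rightarrow> 's measure) \<Rightarrow> ('s \<Rightarrow> 'a measure) \<Rightarrow>
    real \<Rightarrow> 's \<Rightarrow> 's measure" where
  "state_occupancy S P \<pi> \<gamma> s = \<pi> s \<bind> (\<lambda>a. occupancy S P \<pi> \<gamma> s a)"

text \<open>The state distribution at step \<open>n \<ge> 1\<close> of a rollout started in \<open>s\<close>; step 0 is \<open>s\<close> itself.\<close>

fun rollout :: "'s measure \<Rightarrow> ('s \<times> 'a \<Rightarrow> 's measure) \<Rightarrow> ('s \<Rightarrow> 'a measure) \<Rightarrow>
    real \<Rightarrow> nat \<Rightarrow> 's \<Rightarrow> 's measure" where
  "rollout S P \<pi> \<gamma> 0 s = return S s"
| "rollout S P \<pi> \<gamma> (Suc 0) s = state_occupancy S P \<pi> \<gamma> s"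
| "rollout S P \<pi> \<gamma> (Suc (Suc n)) s =
     rollout S P \<pi> \<gamma> (Suc n) s \<bind> (\<lambda>s'. state_occupancy S P \<pi> \<gamma> s')"

definition rollout_weight :: "real \<Rightarrow> real \<Rightarrow> nat \<Rightarrow> real" where
  "rollout_weight \<gamma> \<gamma>' n = (1 - \<gamma>') * (\<gamma>' - \<gamma>) ^ (n - 1) / (1 - \<gamma>) ^ n"

end

theory Submission
  imports Defs
begin

text \<open>Write \<open>Q\<close> for the kernel of the \<open>\<gamma>\<close>-model and \<open>Q'\<close> for that of the \<open>\<gamma>'\<close>-model. The
  resolvent identity
  \<open>(1 - \<gamma>) Q' = (1 - \<gamma>') Q + (\<gamma>' - \<gamma>) Q Q'\<close>
  holds because the occupancy at \<open>\<gamma>'\<close> satisfies a Bellman equation along the state chain, whose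
  continuation weight \<open>\<gamma>'\<close> is split as \<open>(\<gamma>' - \<gamma>) + \<gamma>\<close> and only the part \<open>\<gamma>\<close> unrolled.
  Unrolling the resolvent identity itself along the rollout gives the series with the
  weights of the theorem, since \<open>(\<gamma>' - \<gamma>) / (1 - \<gamma>) < 1\<close>.\<close>

section \<open>Series solution of an affine recurrence\<close>

text \<open>After \<open>n\<close> substitutions the remainder is \<open>c ^ n * h n\<close>, which
  tends to 0 because \<open>h\<close> is bounded. The bound matters: for \<open>b = 0\<close> and
  \<open>0 < c\<close>, the sequence \<open>1 / c ^ k\<close> solves the recurrence as well. The
  lemma serves twice, first along the state chain and then along the rollout.\<close>

lemma unroll_recurrence_ennreal:
  fixes h b :: "nat \<Rightarrow> ennreal"
  assumes c: "0 \<le> c" "c < 1"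
    and step: "\<And>k. h k = b k + ennreal c * h (Suc k)"
    and bound: "\<And>k. h k \<le> 1"
  shows "h 0 = (\<Sum>k. ennreal (c ^ k) * b k)"
proof -
  have partial: "h 0 = (\<Sum>k<n. ennreal (c ^ k) * b k) + ennreal (c ^ n) * h n" for n
  proof (induction n)
    case (Suc n)
    have "ennreal (c ^ n) * h n = ennreal (c ^ n) * b n + ennreal (c ^ Suc n) * h (Suc n)"
      using c by (subst step) (simp add: distrib_left ennreal_mult ac_simps)
    then show ?case
      using Suc by (simp add: add.assoc)
  qed simp
  have lim: "(\<lambda>n. ennreal (c ^ n)) \<longlonglongrightarrow> 0"
    using c tendsto_ennrealI[OF LIMSEQ_realpow_zero[of c]] by simp
  have "ennreal (c ^ n) * h n \<le> ennreal (c ^ n)" for n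
    using mult_left_mono[OF bound[of n], of "ennreal (c ^ n)"] by simp
  then have "(\<lambda>n. ennreal (c ^ n) * h n) \<longlonglongrightarrow> 0"
    by (intro tendsto_sandwich[OF _ _ tendsto_const lim]) auto
  from tendsto_add[OF summable_LIMSEQ[of "\<lambda>k. ennreal (c ^ k) * b k"] this]
  have "(\<lambda>n. h 0) \<longlonglongrightarrow> (\<Sum>k. ennreal (c ^ k) * b k)"
    by (simp flip: partial)
  then show ?thesis
    by (simp add: LIMSEQ_const_iff)
qed

section \<open>Countable mixtures of measures\<close>

text \<open>Both sides are additive, homogeneous and continuous along increasing sequences in
  \<open>f\<close>, and on indicators they agree by \<open>emeasure_mixture\<close>.\<close>

lemma nn_integral_mixture:
  assumes M: "\<And>n. n \<ge> 1 \<Longrightarrow> sets (M n) = sets S" and f: "f \<in> borel_measurable S"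
  shows "(\<integral>\<^sup>+x. f x \<partial>mixture S w M) = (\<Sum>n. ennreal (w (Suc n)) * (\<integral>\<^sup>+x. f x \<partial>M (Suc n)))"
proof -
  have sets_M: "sets (M (Suc n)) = sets S" for n
    using M[of "Suc n"] by simp
  have space_M: "space (M (Suc n)) = space S" for n
    using sets_eq_imp_space_eq[OF sets_M] .
  note meas_M = measurable_cong_sets[OF sets_M refl]
  note meas_mix = measurable_cong_sets[OF sets_mixture refl]
  show ?thesis
    using f
  proof (induction rule: borel_measurable_induct)
    case (cong f g)
    have "(\<integral>\<^sup>+x. f x \<partial>N) = (\<integral>\<^sup>+x. g x \<partial>N)" if "space N = space S" for N
      using cong that by (intro nn_integral_cong) auto
    then show ?case
      using cong by (simp add: space_M)
  next
    case (set B)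
    then show ?case
      by (simp add: emeasure_mixture[OF M] sets_M)
  next
    case (mult u c)
    then show ?case
      by (simp add: nn_integral_cmult meas_M meas_mix mult.left_commute
          flip: ennreal_suminf_cmult)
  next
    case (add u v)
    then show ?case
      by (simp add: nn_integral_add meas_M meas_mix distrib_left flip: suminf_add)
  next
    case (seq U)
    have sup: "(\<integral>\<^sup>+x. Sup (range U) x \<partial>N) = (SUP i. \<integral>\<^sup>+x. U i x \<partial>N)" if "sets N = sets S" for N
      using seq.hyps(1,3) nn_integral_monotone_convergence_SUP[of U N]
      by (simp add: measurable_cong_sets[OF that refl] image_comp)
    \<comment> \<open>Each summand grows with \<open>i\<close>, so the supremum may be exchanged
      with the series.\<close>
    have inc: "incseq (\<lambda>i. ennreal (w (Suc n)) * (\<integral>\<^sup>+x. U i x \<partial>M (Suc n)))" for n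
      using seq.hyps(3) by (auto simp: incseq_def le_fun_def intro!: mult_left_mono nn_integral_mono)
    show ?case
      by (simp add: sup sets_M seq.IH SUP_mult_left_ennreal ennreal_suminf_SUP_eq[OF inc]
          del: Sup_apply SUP_apply)
  qed
qed

lemma prob_space_mixture:
  assumes M: "\<And>n. n \<ge> 1 \<Longrightarrow> M n \<in> space (prob_algebra S)"
    and w: "\<And>n. n \<ge> 1 \<Longrightarrow> 0 \<le> w n" "(\<lambda>n. w (Suc n)) sums 1"
  shows "mixture S w M \<in> space (prob_algebra S)"
proof -
  have sets_M: "sets (M n) = sets S" and prob_M: "prob_space (M n)" if "n \<ge> 1" for n
    using M[OF that] by (simp_all add: space_prob_algebra)
  have "emeasure (M (Suc n)) (space S) = 1" for n
    using prob_space.emeasure_space_1[OF prob_M[of "Suc n"]]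
      sets_eq_imp_space_eq[OF sets_M[of "Suc n"]] by simp
  then have "emeasure (mixture S w M) (space S) = (\<Sum>n. ennreal (w (Suc n)))"
    by (simp add: emeasure_mixture[OF sets_M])
  also have "\<dots> = 1"
    using suminf_ennreal_eq[OF w(1) w(2)] by simp
  finally show ?thesis
    by (auto simp: space_prob_algebra intro!: prob_spaceI)
qed

text \<open>The probability of a fixed event is a countable series of measurable functions of the
  parameter. Mixtures of kernels are thus kernels and can themselves be composed and
  iterated.\<close>

lemma measurable_mixture:
  assumes M: "\<And>n. n \<ge> 1 \<Longrightarrow> (\<lambda>x. M x n) \<in> L \<rightarrow>\<^sub>M prob_algebra S"
    and w: "\<And>n. n \<ge> 1 \<Longrightarrow> 0 \<le> w n" "(\<lambda>n. w (Suc n)) sums 1"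
  shows "(\<lambda>x. mixture S w (M x)) \<in> L \<rightarrow>\<^sub>M prob_algebra S"
proof -
  have "mixture S w (M x) \<in> space (prob_algebra S)" if "x \<in> space L" for x
    using measurable_space[OF M that] w by (intro prob_space_mixture)
  then have prob: "prob_space (mixture S w (M x))" if "x \<in> space L" for x
    using that by (simp add: space_prob_algebra)
  have sets_M: "sets (M x n) = sets S" if "x \<in> space L" "n \<ge> 1" for x n
    using measurable_space[OF M[OF that(2)] that(1)] by (simp add: space_prob_algebra)
  have "(\<lambda>x. emeasure (mixture S w (M x)) B) \<in> borel_measurable L" if B: "B \<in> sets S" for B
  proof (subst measurable_cong[OF emeasure_mixture[OF sets_M B]])
    have [measurable]: "(\<lambda>x. emeasure (M x (Suc n)) B) \<in> borel_measurable L" for n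
      using measurable_emeasure_kernel[OF measurable_prob_algebraD[OF M] B] by simp
    show "(\<lambda>x. \<Sum>n. ennreal (w (Suc n)) * emeasure (M x (Suc n)) B) \<in> borel_measurable L"
      by measurable
  qed
  then show ?thesis
    using prob by (intro measurable_prob_algebraI measurable_subprob_algebra)
      (auto intro: prob_space_imp_subprob_space)
qed

section \<open>Iterates of a Markov kernel\<close>

text \<open>Each new step is appended at the end, as in \<open>state_law\<close> and
  \<open>rollout\<close>, so that inductions over those functions match this recursion.\<close>

primrec kernel_power :: "'s measure \<Rightarrow> ('s \<Rightarrow> 's measure) \<Rightarrow> nat \<Rightarrow> 's \<Rightarrow> 's measure" where
  "kernel_power S K 0 s = return S s"
| "kernel_power S K (Suc n) s = kernel_power S K n s \<bind> K"

lemma measurable_kernel_power: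
  assumes "K \<in> S \<rightarrow>\<^sub>M prob_algebra S"
  shows "kernel_power S K n \<in> S \<rightarrow>\<^sub>M prob_algebra S"
proof (induction n)
  case 0
  then show ?case
    by (simp add: measurable_return_prob_space cong: measurable_cong)
next
  case (Suc n)
  then show ?case
    using assms by (auto intro: measurable_bind_prob_space cong: measurable_cong)
qed

lemma kernel_power_in_space:
  assumes "K \<in> S \<rightarrow>\<^sub>M prob_algebra S" and "s \<in> space S"
  shows "sets (kernel_power S K n s) = sets S" and "prob_space (kernel_power S K n s)"
  using measurable_space[OF measurable_kernel_power[OF assms(1)] assms(2), of n]
  by (simp_all add: space_prob_algebra)

lemma kernel_power_1:
  assumes "K \<in> S \<rightarrow>\<^sub>M prob_algebra S" and "s \<in> space S"
  shows "kernel_power S K (Suc 0) s = K s"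
  using bind_return[OF measurable_prob_algebraD[OF assms(1)] assms(2)] by simp

text \<open>The Chapman-Kolmogorov equation, a consequence of the associativity of bind.\<close>

lemma kernel_power_add:
  assumes K: "K \<in> S \<rightarrow>\<^sub>M prob_algebra S" and s: "s \<in> space S"
  shows "kernel_power S K m s \<bind> kernel_power S K n = kernel_power S K (m + n) s"
proof (induction n)
  case 0
  have "kernel_power S K 0 = return S"
    by auto
  then show ?case
    by (simp add: bind_return'' kernel_power_in_space[OF K s])
next
  case (Suc n)
  have "kernel_power S K n \<in> kernel_power S K m s \<rightarrow>\<^sub>M subprob_algebra S"
    using measurable_prob_algebraD[OF measurable_kernel_power[OF K]]
    by (simp add: measurable_cong_sets[OF kernel_power_in_space(1)[OF K s] refl])
  from bind_assoc[OF this measurable_prob_algebraD[OF K]] show ?case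
    using Suc by simp
qed

section \<open>Chains stopped at a geometric time and their resolvent identity\<close>

text \<open>For \<open>0 \<le> \<gamma> < 1\<close> this is the normalized resolvent
  \<open>(1 - \<gamma>) K (1 - \<gamma> K)^(-1)\<close> in operator notation. It is the counterpart
  of \<open>state_occupancy\<close> for a chain without actions.\<close>

definition geometric_kernel :: "'s measure \<Rightarrow> ('s \<Rightarrow> 's measure) \<Rightarrow> real \<Rightarrow> 's \<Rightarrow> 's measure" where
  "geometric_kernel S K \<gamma> s =
     mixture S (\<lambda>k. (1 - \<gamma>) * \<gamma> ^ (k - 1)) (\<lambda>k. kernel_power S K k s)"

lemma geometric_weights_sums:
  fixes \<gamma> :: real
  assumes "0 \<le> \<gamma>" "\<gamma> < 1"
  shows "(\<lambda>n. (1 - \<gamma>) * \<gamma> ^ (Suc n - 1)) sums 1"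
  using sums_mult[OF geometric_sums[of \<gamma>], of "1 - \<gamma>"] assms by simp

lemma measurable_geometric_kernel:
  assumes "K \<in> S \<rightarrow>\<^sub>M prob_algebra S" and "0 \<le> \<gamma>" "\<gamma> < 1"
  shows "geometric_kernel S K \<gamma> \<in> S \<rightarrow>\<^sub>M prob_algebra S"
  unfolding geometric_kernel_def[abs_def] using assms geometric_weights_sums[of \<gamma>]
  by (intro measurable_mixture measurable_kernel_power) auto

lemma emeasure_geometric_kernel:
  assumes "K \<in> S \<rightarrow>\<^sub>M prob_algebra S" and "s \<in> space S" and "B \<in> sets S"
  shows "emeasure (geometric_kernel S K \<gamma> s) B =
    (\<Sum>k. ennreal ((1 - \<gamma>) * \<gamma> ^ k) * emeasure (kernel_power S K (Suc k) s) B)"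
  unfolding geometric_kernel_def
  by (subst emeasure_mixture[OF kernel_power_in_space(1)[OF assms(1,2)] assms(3)]) simp

lemma nn_integral_geometric_kernel:
  assumes "K \<in> S \<rightarrow>\<^sub>M prob_algebra S" and "s \<in> space S" and "f \<in> borel_measurable S"
  shows "(\<integral>\<^sup>+x. f x \<partial>geometric_kernel S K \<gamma> s) =
    (\<Sum>k. ennreal ((1 - \<gamma>) * \<gamma> ^ k) * (\<integral>\<^sup>+x. f x \<partial>kernel_power S K (Suc k) s))"
  unfolding geometric_kernel_def
  by (subst nn_integral_mixture[OF kernel_power_in_space(1)[OF assms(1,2)] assms(3)]) simp

text \<open>Supplies the bound that \<open>unroll_recurrence_ennreal\<close> asks for.\<close>

lemma nn_integral_emeasure_kernel_le_1:
  assumes L: "L \<in> S \<rightarrow>\<^sub>M prob_algebra S" and M: "M \<in> space (prob_algebra S)"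
  shows "(\<integral>\<^sup>+x. emeasure (L x) B \<partial>M) \<le> 1"
proof -
  have M: "space M = space S" "prob_space M"
    using M sets_eq_imp_space_eq[of M S] by (auto simp: space_prob_algebra)
  have "emeasure (L x) B \<le> 1" if "x \<in> space M" for x
    using measurable_space[OF L, of x] that M(1)
    by (auto simp: space_prob_algebra intro: prob_space.measure_le_1)
  then have "(\<integral>\<^sup>+x. emeasure (L x) B \<partial>M) \<le> (\<integral>\<^sup>+x. 1 \<partial>M)"
    by (rule nn_integral_mono)
  then show ?thesis
    using prob_space.emeasure_space_1[OF M(2)] by simp
qed

text \<open>In operator notation, clearing the denominators \<open>1 - \<gamma> K\<close> and
  \<open>1 - \<gamma>' K\<close> reduces the claim to \<open>1 - \<gamma> K = (1 - \<gamma>' K) +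
  (\<gamma>' - \<gamma>) K\<close>. The terms are arranged with nonnegative coefficients, so that no
  subtraction occurs in \<open>ennreal\<close>.\<close>

lemma resolvent_identity:
  assumes K: "K \<in> S \<rightarrow>\<^sub>M prob_algebra S" and s: "s \<in> space S" and B: "B \<in> sets S"
    and \<gamma>: "0 \<le> \<gamma>" "\<gamma> \<le> \<gamma>'" "\<gamma>' < 1"
  shows "ennreal (1 - \<gamma>) * emeasure (geometric_kernel S K \<gamma>' s) B =
    ennreal (1 - \<gamma>') * emeasure (geometric_kernel S K \<gamma> s) B +
    ennreal (\<gamma>' - \<gamma>) * (\<integral>\<^sup>+x. emeasure (geometric_kernel S K \<gamma>' x) B \<partial>geometric_kernel S K \<gamma> s)"
proof -
  define x where "x i = emeasure (kernel_power S K i s) B" for i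
  \<comment> \<open>The probability of hitting \<open>B\<close> when \<open>k\<close> steps of the
    chain are followed by one sample of the \<open>\<gamma>'\<close>-model; \<open>H 0\<close> is
    the quantity on the left of the claim.\<close>
  define H where "H k = (\<integral>\<^sup>+y. emeasure (geometric_kernel S K \<gamma>' y) B \<partial>kernel_power S K k s)" for k
  note power_s = kernel_power_in_space[OF K s]
  have Q': "geometric_kernel S K \<gamma>' \<in> S \<rightarrow>\<^sub>M prob_algebra S"
    using \<gamma> by (intro measurable_geometric_kernel[OF K]) auto
  have meas_Q': "(\<lambda>y. emeasure (geometric_kernel S K \<gamma>' y) B) \<in> borel_measurable S"
    using measurable_emeasure_kernel[OF measurable_prob_algebraD[OF Q'] B] .
  have meas_power: "(\<lambda>y. emeasure (kernel_power S K i y) B) \<in> borel_measurable S" for i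
    using measurable_emeasure_kernel[OF measurable_prob_algebraD[OF measurable_kernel_power[OF K]] B] .
  have power_B: "(\<integral>\<^sup>+y. emeasure (kernel_power S K i y) B \<partial>kernel_power S K k s) = x (k + i)" for i k
    unfolding x_def kernel_power_add[OF K s, symmetric]
    by (rule emeasure_bind_prob_algebra[symmetric, OF _ measurable_kernel_power[OF K] B])
      (simp add: space_prob_algebra power_s)
  have H_series: "H k = (\<Sum>j. ennreal ((1 - \<gamma>') * \<gamma>' ^ j) * x (Suc (k + j)))" for k
  proof -
    have "H k = (\<integral>\<^sup>+y. (\<Sum>j. ennreal ((1 - \<gamma>') * \<gamma>' ^ j) * emeasure (kernel_power S K (Suc j) y) B)
        \<partial>kernel_power S K k s)"
      unfolding H_def using B
      by (intro nn_integral_cong emeasure_geometric_kernel[OF K])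
        (auto simp: sets_eq_imp_space_eq[OF power_s(1)])
    also have "\<dots> = (\<Sum>j. \<integral>\<^sup>+y. ennreal ((1 - \<gamma>') * \<gamma>' ^ j) * emeasure (kernel_power S K (Suc j) y) B
        \<partial>kernel_power S K k s)"
      using meas_power
      by (intro nn_integral_suminf) (simp add: measurable_cong_sets[OF power_s(1) refl] del: kernel_power.simps)
    also have "\<dots> = (\<Sum>j. ennreal ((1 - \<gamma>') * \<gamma>' ^ j) * x (Suc (k + j)))"
      using meas_power
      by (simp add: nn_integral_cmult measurable_cong_sets[OF power_s(1) refl] power_B
          del: kernel_power.simps)
    finally show ?thesis .
  qed
  \<comment> \<open>The Bellman equation: the \<open>\<gamma>'\<close>-model stops after one step
    with probability \<open>1 - \<gamma>'\<close>, and otherwise starts afresh from the state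
    reached.\<close>
  have H_step: "H k = ennreal (1 - \<gamma>') * x (Suc k) + ennreal \<gamma>' * H (Suc k)" for k
  proof -
    let ?f = "\<lambda>j. ennreal ((1 - \<gamma>') * \<gamma>' ^ j) * x (Suc (k + j))"
    have "H k = ?f 0 + (\<Sum>j. ?f (Suc j))"
      using suminf_offset[of ?f 1] by (simp add: H_series add.commute)
    also have "(\<Sum>j. ?f (Suc j)) =
        (\<Sum>j. ennreal \<gamma>' * (ennreal ((1 - \<gamma>') * \<gamma>' ^ j) * x (Suc (Suc k + j))))"
      using \<gamma> by (intro suminf_cong) (simp add: ennreal_mult ac_simps)
    finally show ?thesis
      by (simp add: H_series)
  qed
  have split_weight: "ennreal \<gamma>' = ennreal (\<gamma>' - \<gamma>) + ennreal \<gamma>"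
    using \<gamma> by (subst ennreal_plus[symmetric]) auto
  \<comment> \<open>Only the part with factor \<open>\<gamma>\<close> is to be unrolled; the part
    with factor \<open>\<gamma>' - \<gamma>\<close> joins the inhomogeneous term.\<close>
  have H_split: "H k = (ennreal (1 - \<gamma>') * x (Suc k) + ennreal (\<gamma>' - \<gamma>) * H (Suc k))
      + ennreal \<gamma> * H (Suc k)" for k
    unfolding H_step[of k] split_weight by (simp only: distrib_right add.assoc)
  have H_le_1: "H k \<le> 1" for k
    unfolding H_def
    by (intro nn_integral_emeasure_kernel_le_1[OF Q']) (simp add: space_prob_algebra power_s)
  have "H 0 =
      (\<Sum>k. ennreal (\<gamma> ^ k) * (ennreal (1 - \<gamma>') * x (Suc k) + ennreal (\<gamma>' - \<gamma>) * H (Suc k)))"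
    using \<gamma> by (intro unroll_recurrence_ennreal H_split H_le_1) auto
  \<comment> \<open>The factor \<open>1 - \<gamma>\<close> turns the powers
    \<open>\<gamma> ^ k\<close> into the geometric weights. The index \<open>Suc k\<close> fits
    because the geometric time starts at 1.\<close>
  then have "ennreal (1 - \<gamma>) * H 0 =
      (\<Sum>k. ennreal (1 - \<gamma>') * (ennreal ((1 - \<gamma>) * \<gamma> ^ k) * x (Suc k)) +
         ennreal (\<gamma>' - \<gamma>) * (ennreal ((1 - \<gamma>) * \<gamma> ^ k) * H (Suc k)))"
    using \<gamma> by (simp add: ennreal_mult distrib_left ac_simps flip: ennreal_suminf_cmult)
  also have "\<dots> =
      ennreal (1 - \<gamma>') * (\<Sum>k. ennreal ((1 - \<gamma>) * \<gamma> ^ k) * x (Suc k)) +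
      ennreal (\<gamma>' - \<gamma>) * (\<Sum>k. ennreal ((1 - \<gamma>) * \<gamma> ^ k) * H (Suc k))"
    by (simp flip: suminf_add)
  also have "(\<Sum>k. ennreal ((1 - \<gamma>) * \<gamma> ^ k) * x (Suc k)) = emeasure (geometric_kernel S K \<gamma> s) B"
    unfolding x_def by (rule emeasure_geometric_kernel[symmetric, OF K s B])
  also have "(\<Sum>k. ennreal ((1 - \<gamma>) * \<gamma> ^ k) * H (Suc k)) =
      (\<integral>\<^sup>+y. emeasure (geometric_kernel S K \<gamma>' y) B \<partial>geometric_kernel S K \<gamma> s)"
    unfolding H_def by (rule nn_integral_geometric_kernel[symmetric, OF K s meas_Q'])
  also have "H 0 = emeasure (geometric_kernel S K \<gamma>' s) B"
    unfolding H_def using s meas_Q' by (simp add: nn_integral_return)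
  finally show ?thesis .
qed

text \<open>Integrating the resolvent identity against the law of the \<open>n\<close>-th iterate of
  the \<open>\<gamma>\<close>-model gives an affine recurrence in \<open>n\<close>, whose series
  solution is the mixture.\<close>

lemma geometric_kernel_eq_mixture:
  assumes K: "K \<in> S \<rightarrow>\<^sub>M prob_algebra S" and s: "s \<in> space S"
    and \<gamma>: "0 \<le> \<gamma>" "\<gamma> \<le> \<gamma>'" "\<gamma>' < 1"
  shows "geometric_kernel S K \<gamma>' s =
    mixture S (rollout_weight \<gamma> \<gamma>') (\<lambda>n. kernel_power S (geometric_kernel S K \<gamma>) n s)"
proof (rule measure_eqI)
  let ?Q = "geometric_kernel S K \<gamma>" and ?Q' = "geometric_kernel S K \<gamma>'"
  have Q: "?Q \<in> S \<rightarrow>\<^sub>M prob_algebra S" and Q': "?Q' \<in> S \<rightarrow>\<^sub>M prob_algebra S"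
    using \<gamma> by (auto intro!: measurable_geometric_kernel[OF K])
  note power_s = kernel_power_in_space[OF Q s]
  show "sets (?Q' s) = sets (mixture S (rollout_weight \<gamma> \<gamma>') (\<lambda>n. kernel_power S ?Q n s))"
    by (simp add: geometric_kernel_def)
  fix B assume "B \<in> sets (?Q' s)"
  then have B: "B \<in> sets S"
    by (simp add: geometric_kernel_def)
  \<comment> \<open>Dividing the resolvent identity by \<open>1 - \<gamma>\<close> leaves the
    coefficients \<open>q\<close> and \<open>r\<close>. Since \<open>q + r = 1\<close>, the weights
    \<open>r ^ n * q\<close> are geometric with ratio \<open>r\<close>.\<close>
  define r where "r = (\<gamma>' - \<gamma>) / (1 - \<gamma>)"
  define q where "q = (1 - \<gamma>') / (1 - \<gamma>)"
  have r: "0 \<le> r" "r < 1" and q: "0 \<le> q"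
    using \<gamma> by (simp_all add: r_def q_def divide_less_eq)
  define I where "I n = (\<integral>\<^sup>+y. emeasure (?Q' y) B \<partial>kernel_power S ?Q n s)" for n
  have meas_Q: "(\<lambda>y. emeasure (?Q y) B) \<in> borel_measurable S"
    using measurable_emeasure_kernel[OF measurable_prob_algebraD[OF Q] B] .
  have meas_Q': "(\<lambda>y. emeasure (?Q' y) B) \<in> borel_measurable S"
    using measurable_emeasure_kernel[OF measurable_prob_algebraD[OF Q'] B] .
  have meas_QQ': "(\<lambda>y. \<integral>\<^sup>+z. emeasure (?Q' z) B \<partial>?Q y) \<in> borel_measurable S"
    using measurable_compose[OF measurable_prob_algebraD[OF Q]
        nn_integral_measurable_subprob_algebra[OF meas_Q']] .
  have resolvent: "emeasure (?Q' y) B =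
      ennreal q * emeasure (?Q y) B + ennreal r * (\<integral>\<^sup>+z. emeasure (?Q' z) B \<partial>?Q y)"
    if "y \<in> space S" for y
  proof -
    \<comment> \<open>Division is written as multiplication by a real inverse, so that the
      coefficients can be combined in the reals.\<close>
    have "emeasure (?Q' y) B = ennreal (1 / (1 - \<gamma>)) * (ennreal (1 - \<gamma>) * emeasure (?Q' y) B)"
      using \<gamma> by (simp flip: mult.assoc ennreal_mult)
    then show ?thesis
      using \<gamma> unfolding resolvent_identity[OF K that B \<gamma>]
      by (simp add: distrib_left q_def r_def flip: mult.assoc ennreal_mult)
  qed
  \<comment> \<open>Integrating \<open>?Q y\<close> over the \<open>n\<close>-th iterate appends one
    more step of the \<open>\<gamma>\<close>-model, which raises the index to \<open>Suc n\<close>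
    in both terms.\<close>
  have I_step: "I n = ennreal q * emeasure (kernel_power S ?Q (Suc n) s) B + ennreal r * I (Suc n)" for n
  proof -
    have kernel: "?Q \<in> kernel_power S ?Q n s \<rightarrow>\<^sub>M subprob_algebra S"
      using measurable_prob_algebraD[OF Q] by (simp add: measurable_cong_sets[OF power_s(1) refl])
    have "I n = (\<integral>\<^sup>+y. ennreal q * emeasure (?Q y) B + ennreal r * (\<integral>\<^sup>+z. emeasure (?Q' z) B \<partial>?Q y)
        \<partial>kernel_power S ?Q n s)"
      unfolding I_def
      by (intro nn_integral_cong resolvent) (simp add: sets_eq_imp_space_eq[OF power_s(1)])
    also have "\<dots> = ennreal q * (\<integral>\<^sup>+y. emeasure (?Q y) B \<partial>kernel_power S ?Q n s) +
        ennreal r * (\<integral>\<^sup>+y. \<integral>\<^sup>+z. emeasure (?Q' z) B \<partial>?Q y \<partial>kernel_power S ?Q n s)"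
      using meas_Q meas_QQ'
      by (simp add: nn_integral_add nn_integral_cmult measurable_cong_sets[OF power_s(1) refl])
    also have "(\<integral>\<^sup>+y. emeasure (?Q y) B \<partial>kernel_power S ?Q n s) =
        emeasure (kernel_power S ?Q (Suc n) s) B"
      using emeasure_bind_prob_algebra[OF _ Q B] by (simp add: space_prob_algebra power_s)
    also have "(\<integral>\<^sup>+y. \<integral>\<^sup>+z. emeasure (?Q' z) B \<partial>?Q y \<partial>kernel_power S ?Q n s) = I (Suc n)"
      using nn_integral_bind[OF meas_Q' kernel] by (simp add: I_def)
    finally show ?thesis .
  qed
  have I_le_1: "I n \<le> 1" for n
    unfolding I_def
    by (intro nn_integral_emeasure_kernel_le_1[OF Q']) (simp add: space_prob_algebra power_s)
  have "I 0 = (\<Sum>n. ennreal (r ^ n) * (ennreal q * emeasure (kernel_power S ?Q (Suc n) s) B))"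
    using r by (intro unroll_recurrence_ennreal I_step I_le_1)
  also have "\<dots> = (\<Sum>n. ennreal (rollout_weight \<gamma> \<gamma>' (Suc n)) * emeasure (kernel_power S ?Q (Suc n) s) B)"
  proof (intro suminf_cong)
    fix n
    have "rollout_weight \<gamma> \<gamma>' (Suc n) = r ^ n * q"
      by (simp add: rollout_weight_def r_def q_def power_divide mult.commute)
    then show "ennreal (r ^ n) * (ennreal q * emeasure (kernel_power S ?Q (Suc n) s) B) =
        ennreal (rollout_weight \<gamma> \<gamma>' (Suc n)) * emeasure (kernel_power S ?Q (Suc n) s) B"
      using r q by (simp add: ennreal_mult mult.assoc)
  qed
  also have "\<dots> = emeasure (mixture S (rollout_weight \<gamma> \<gamma>') (\<lambda>n. kernel_power S ?Q n s)) B"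
    by (rule emeasure_mixture[symmetric, OF power_s(1) B])
  also have "I 0 = emeasure (?Q' s) B"
    unfolding I_def using s meas_Q' by (simp add: nn_integral_return)
  finally show "emeasure (?Q' s) B =
      emeasure (mixture S (rollout_weight \<gamma> \<gamma>') (\<lambda>n. kernel_power S ?Q n s)) B" .
qed

section \<open>From the decision process to the chain induced by the policy\<close>

text \<open>Only the first action is prescribed; every later one is averaged over
  \<open>\<pi>\<close>, so the remaining \<open>k\<close> steps are steps of
  \<open>K\<close>.\<close>

lemma state_law_eq_bind:
  assumes P: "P \<in> S \<Otimes>\<^sub>M A \<rightarrow>\<^sub>M prob_algebra S" and K: "K \<in> S \<rightarrow>\<^sub>M prob_algebra S"
    and K_def: "K = (\<lambda>s. \<pi> s \<bind> (\<lambda>a. P (s, a)))"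
    and s: "s \<in> space S" and a: "a \<in> space A"
  shows "state_law S P \<pi> (Suc k) s a = P (s, a) \<bind> kernel_power S K k"
proof (induction k)
  case 0
  have "sets (P (s, a)) = sets S"
    using measurable_space[OF P, of "(s, a)"] s a by (simp add: space_pair_measure space_prob_algebra)
  moreover have "kernel_power S K 0 = return S"
    by auto
  ultimately show ?case
    by (simp add: bind_return'')
next
  case (Suc k)
  have sets_P: "sets (P (s, a)) = sets S"
    using measurable_space[OF P, of "(s, a)"] s a by (simp add: space_pair_measure space_prob_algebra)
  have "kernel_power S K k \<in> P (s, a) \<rightarrow>\<^sub>M subprob_algebra S"
    using measurable_prob_algebraD[OF measurable_kernel_power[OF K]]
    by (simp add: measurable_cong_sets[OF sets_P refl])
  from bind_assoc[OF this measurable_prob_algebraD[OF K]] show ?case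
    using Suc by (simp flip: K_def)
qed

text \<open>Averaging the first action over \<open>\<pi>\<close> makes the first step a step of
  \<open>K\<close> too. This average commutes with the geometric series, so actions disappear from
  the problem.\<close>

lemma state_occupancy_eq_geometric_kernel:
  assumes P: "P \<in> S \<Otimes>\<^sub>M A \<rightarrow>\<^sub>M prob_algebra S" and \<pi>: "\<pi> \<in> S \<rightarrow>\<^sub>M prob_algebra A"
    and K: "K \<in> S \<rightarrow>\<^sub>M prob_algebra S"
    and K_def: "K = (\<lambda>s. \<pi> s \<bind> (\<lambda>a. P (s, a)))"
    and \<gamma>: "0 \<le> \<gamma>" "\<gamma> < 1" and s: "s \<in> space S"
  shows "state_occupancy S P \<pi> \<gamma> s = geometric_kernel S K \<gamma> s"
proof (rule measure_eqI)
  have \<pi>_s: "\<pi> s \<in> space (prob_algebra A)"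
    using measurable_space[OF \<pi> s] .
  then have sets_\<pi>: "sets (\<pi> s) = sets A"
    by (simp add: space_prob_algebra)
  have P_s: "(\<lambda>a. P (s, a)) \<in> A \<rightarrow>\<^sub>M prob_algebra S"
    using s P by measurable
  \<comment> \<open>The description by \<open>kernel_power\<close> is available only for actions in
    \<open>space A\<close>, which is enough for measurability on \<open>A\<close>.\<close>
  have law: "(\<lambda>a. state_law S P \<pi> (Suc k) s a) \<in> A \<rightarrow>\<^sub>M prob_algebra S" for k
    using measurable_bind_prob_space[OF P_s measurable_kernel_power[OF K]]
    by (subst measurable_cong[OF state_law_eq_bind[OF P K K_def s]])
  have law_power: "\<pi> s \<bind> (\<lambda>a. state_law S P \<pi> (Suc k) s a) = kernel_power S K (Suc k) s" for k
  proof -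
    have "(\<lambda>a. P (s, a)) \<in> \<pi> s \<rightarrow>\<^sub>M subprob_algebra S"
      using measurable_prob_algebraD[OF P_s] by (simp add: measurable_cong_sets[OF sets_\<pi> refl])
    from bind_assoc[OF this measurable_prob_algebraD[OF measurable_kernel_power[OF K]]]
    have "\<pi> s \<bind> (\<lambda>a. P (s, a) \<bind> kernel_power S K k) = K s \<bind> kernel_power S K k"
      by (simp add: K_def)
    also have "\<dots> = kernel_power S K (Suc k) s"
      using kernel_power_add[OF K s, of 1 k] kernel_power_1[OF K s] by simp
    also have "\<pi> s \<bind> (\<lambda>a. P (s, a) \<bind> kernel_power S K k) =
        \<pi> s \<bind> (\<lambda>a. state_law S P \<pi> (Suc k) s a)"
      by (intro bind_cong refl)
        (simp add: state_law_eq_bind[OF P K K_def s] sets_eq_imp_space_eq[OF sets_\<pi>])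
    finally show ?thesis .
  qed
  have sets_law: "sets (state_law S P \<pi> n s a) = sets S" if "a \<in> space A" "n \<ge> 1" for n a
    using measurable_space[OF law that(1), of "n - 1"] that(2) by (simp add: space_prob_algebra)
  have occ: "(\<lambda>a. occupancy S P \<pi> \<gamma> s a) \<in> A \<rightarrow>\<^sub>M prob_algebra S"
    unfolding occupancy_def
  proof (rule measurable_mixture)
    show "(\<lambda>a. state_law S P \<pi> n s a) \<in> A \<rightarrow>\<^sub>M prob_algebra S" if "n \<ge> 1" for n
      using law[of "n - 1"] that by simp
  qed (use \<gamma> geometric_weights_sums[of \<gamma>] in auto)
  show sets_occ: "sets (state_occupancy S P \<pi> \<gamma> s) = sets (geometric_kernel S K \<gamma> s)"
    using sets_bind'[OF \<pi>_s occ] by (simp add: state_occupancy_def geometric_kernel_def)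
  fix B assume "B \<in> sets (state_occupancy S P \<pi> \<gamma> s)"
  then have B: "B \<in> sets S"
    by (simp add: sets_occ geometric_kernel_def)
  have meas_law: "(\<lambda>a. emeasure (state_law S P \<pi> (Suc k) s a) B) \<in> borel_measurable (\<pi> s)" for k
    using measurable_emeasure_kernel[OF measurable_prob_algebraD[OF law] B]
    by (simp add: measurable_cong_sets[OF sets_\<pi> refl])
  have "emeasure (state_occupancy S P \<pi> \<gamma> s) B = (\<integral>\<^sup>+a. emeasure (occupancy S P \<pi> \<gamma> s a) B \<partial>\<pi> s)"
    unfolding state_occupancy_def by (rule emeasure_bind_prob_algebra[OF \<pi>_s occ B])
  also have "\<dots> = (\<integral>\<^sup>+a. (\<Sum>k. ennreal ((1 - \<gamma>) * \<gamma> ^ k) *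
      emeasure (state_law S P \<pi> (Suc k) s a) B) \<partial>\<pi> s)"
    unfolding occupancy_def
    by (intro nn_integral_cong, subst emeasure_mixture[OF sets_law B])
      (simp_all add: sets_eq_imp_space_eq[OF sets_\<pi>])
  \<comment> \<open>All terms are nonnegative and measurable, so series and integral may be
    exchanged; each integral is then the law averaged over the first action.\<close>
  also have "\<dots> = (\<Sum>k. \<integral>\<^sup>+a. ennreal ((1 - \<gamma>) * \<gamma> ^ k) *
      emeasure (state_law S P \<pi> (Suc k) s a) B \<partial>\<pi> s)"
    by (intro nn_integral_suminf borel_measurable_times_ennreal meas_law) simp
  also have "\<dots> = (\<Sum>k. ennreal ((1 - \<gamma>) * \<gamma> ^ k) * emeasure (kernel_power S K (Suc k) s) B)"
    by (simp only: nn_integral_cmult[OF meas_law]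
        emeasure_bind_prob_algebra[OF \<pi>_s law B, symmetric] law_power)
  also have "\<dots> = emeasure (geometric_kernel S K \<gamma> s) B"
    by (rule emeasure_geometric_kernel[symmetric, OF K s B])
  finally show "emeasure (state_occupancy S P \<pi> \<gamma> s) B = emeasure (geometric_kernel S K \<gamma> s) B" .
qed

text \<open>The two kernels are known to agree on \<open>space S\<close> only. This suffices because
  every intermediate law lives on that space.\<close>

lemma rollout_eq_kernel_power:
  assumes Q: "Q \<in> S \<rightarrow>\<^sub>M prob_algebra S"
    and occ: "\<And>s. s \<in> space S \<Longrightarrow> state_occupancy S P \<pi> \<gamma> s = Q s"
    and s: "s \<in> space S"
  shows "rollout S P \<pi> \<gamma> (Suc n) s = kernel_power S Q (Suc n) s"
proof (induction n)
  case 0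
  then show ?case
    using kernel_power_1[OF Q s] by (simp add: occ[OF s])
next
  case (Suc n)
  have "kernel_power S Q (Suc n) s \<bind> state_occupancy S P \<pi> \<gamma> = kernel_power S Q (Suc n) s \<bind> Q"
    using sets_eq_imp_space_eq[OF kernel_power_in_space(1)[OF Q s, of "Suc n"]]
    by (intro bind_cong refl occ) simp
  then show ?case
    using Suc by simp
qed

theorem theorem1:
  fixes S :: "'s measure" and A :: "'a measure"
    and P :: "'s \<times> 'a \<Rightarrow> 's measure" and \<pi> :: "'s \<Rightarrow> 'a measure"
    and \<gamma> \<gamma>' :: real and s :: 's
  assumes transition: "P \<in> S \<Otimes>\<^sub>M A \<rightarrow>\<^sub>M prob_algebra S"
    and policy: "\<pi> \<in> S \<rightarrow>\<^sub>M prob_algebra A"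
    and "0 \<le> \<gamma>" and "\<gamma> < 1"
    and "\<gamma> \<le> \<gamma>'" and "\<gamma>' < 1"
    and "s \<in> space S"
  shows "state_occupancy S P \<pi> \<gamma>' s =
    mixture S (rollout_weight \<gamma> \<gamma>') (\<lambda>n. rollout S P \<pi> \<gamma> n s)"
proof -
  define K where "K = (\<lambda>s. \<pi> s \<bind> (\<lambda>a. P (s, a)))"
  have K: "K \<in> S \<rightarrow>\<^sub>M prob_algebra S"
    unfolding K_def using transition
    by (intro measurable_bind_prob_space2[OF policy]) (simp add: case_prod_eta)
  note occ = state_occupancy_eq_geometric_kernel[OF transition policy K K_def]
  have Q: "geometric_kernel S K \<gamma> \<in> S \<rightarrow>\<^sub>M prob_algebra S"
    using K assms by (intro measurable_geometric_kernel)
  have "rollout S P \<pi> \<gamma> (Suc n) s = kernel_power S (geometric_kernel S K \<gamma>) (Suc n) s" for n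
    using assms by (intro rollout_eq_kernel_power[OF Q occ])
  \<comment> \<open>The definition of \<open>mixture\<close> reads its family only at indices
    \<open>Suc n\<close>, where the two families agree.\<close>
  then have "mixture S (rollout_weight \<gamma> \<gamma>') (\<lambda>n. rollout S P \<pi> \<gamma> n s) =
      mixture S (rollout_weight \<gamma> \<gamma>') (\<lambda>n. kernel_power S (geometric_kernel S K \<gamma>) n s)"
    by (simp only: mixture_def)
  then show ?thesis
    using geometric_kernel_eq_mixture[OF K, of s \<gamma> \<gamma>'] occ[of \<gamma>' s] assms by simp
qed

end
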